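(* Let $p<q$ be odd prime numbers, let $r$ be the remainder of the division of $q$ by $p$, and let $m=\varphi(pq)=(p-1)(q-1)$. Let $\boldsymbol{a}_{pq}$ be the binary cyclotomic word. (1) If $p\ge 3$, then $g_1(\boldsymbol{a}_{pq})=p-1$. There are $\lfloor q/p\rfloor$ such gaps located in $\boldsymbol{a}_{pq}[0:q-1]$ and $\lfloor q/p\rfloor$ such gaps located in $\boldsymbol{a}_{pq}[m-q+1:m]$. (2) If $p\ge 5$ and $r\in\{2,\dots,p-2\}$, then $g_2(\boldsymbol{a}_{pq})=\max\{r-1,\,p-r-1\}$. There are at least $\lfloor q/p\rfloor$ such gaps located in $\boldsymbol{a}_{pq}[q:2q-1]$ and at least $\lfloor q/p\rfloor$ such gaps located in $\boldsymbol{a}_{pq}[m-2q-1:m-q]$.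
   Context: Let $\mathcal{A}=\{-1,0,1\}$. Words over $\mathcal{A}$ are indexed from $0$; $\boldsymbol{u}[j]$ is the $j$-th letter of $\boldsymbol{u}$, $|\boldsymbol{u}|$ its length, and $\boldsymbol{u}[j:t]$ the subword from position $j$ to position $t$ (inclusive), for $0\le j\le t<|\boldsymbol{u}|$. The binary cyclotomic word $\boldsymbol{a}_{pq}\in\mathcal{A}^{m+1}$, $m=(p-1)(q-1)$, is the word whose letters are the coefficients of the cyclotomic polynomial $\Phi_{pq}$, i.e. $\boldsymbol{a}_{pq}[j]$ is the coefficient of $X^j$ in $\Phi_{pq}$. A nonempty word $\boldsymbol{u}$ over $\mathcal{A}$ with at least one zero letter decomposes uniquely as $\boldsymbol{u}=\boldsymbol{u}_0 0^{k_1}\boldsymbol{u}_1 0^{k_2}\boldsymbol{u}_2\cdots\boldsymbol{u}_{t-1}0^{k_t}\boldsymbol{u}_t$ with $t,k_1,\dots,k_t\ge 1$, $\boldsymbol{u}_0,\boldsymbol{u}_t$ (possibly empty) words over $\{-1,1\}$, and $\boldsymbol{u}_1,\dots,\boldsymbol{u}_{t-1}$ nonempty words over $\{-1,1\}$. The blocks $0^{k_1},\dots,0^{k_t}$ (maximal runs of zeros) are the gapblocks of $\boldsymbol{u}$ and $k_1+1,\dots,k_t+1$ are its gaps; $G(\boldsymbol{u})=\{k_i+1:1\le i\le t\}$, $g_1(\boldsymbol{u})=\max G(\boldsymbol{u})$ and $g_2(\boldsymbol{u})=\max(G(\boldsymbol{u})\setminus\{g_1(\boldsymbol{u})\})$.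 Gaps are counted with multiplicity (one per gapblock), and a gap of $\boldsymbol{a}_{pq}$ is located in $\boldsymbol{a}_{pq}[j:t]$ if the corresponding gapblock of $\boldsymbol{a}_{pq}$ occupies positions contained in $\{j,\dots,t\}$. *)

theory Defs
  imports "HOL-Computational_Algebra.Computational_Algebra"
begin

definition primitive_roots :: "nat \<Rightarrow> complex set" where
  "primitive_roots n = {z. z ^ n = 1 \<and> (\<forall>k. 0 < k \<and> k < n \<longrightarrow> z ^ k \<noteq> 1)}"

text \<open>
  The cyclotomic polynomial as an integer polynomial. For \<open>n > 0\<close> the description is proper,
  see \<open>of_int_cyclotomic\<close> below.
\<close>

definition cyclotomic :: "nat \<Rightarrow> int poly" where
  "cyclotomic n =
     (THE P. map_poly of_int P = (\<Prod>z\<in>primitive_roots n. [:- z, 1:]))"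

definition cyclotomic_word :: "nat \<Rightarrow> nat \<Rightarrow> int list" where
  "cyclotomic_word p q =
     map (\<lambda>j. coeff (cyclotomic (p * q)) j) [0..<(p - 1) * (q - 1) + 1]"

text \<open>
  A pair \<open>(i, k)\<close> stands for the maximal run \<open>0\<^sup>k\<close> of zeros that occupies the positions
  \<open>i, \<dots>, i + k - 1\<close>. Keeping the starting position distinguishes different gapblocks
  of equal length, so that cardinalities below count gaps with multiplicity.
\<close>

definition gapblocks :: "int list \<Rightarrow> (nat \<times> nat) set" where
  "gapblocks u = {(i, k). k \<ge> 1 \<and> i + k \<le> length u \<and>
     (\<forall>j. i \<le> j \<and> j < i + k \<longrightarrow> u ! j = 0) \<and>
     (i > 0 \<longrightarrow> u ! (i - 1) \<noteq> 0) \<and>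
     (i + k < length u \<longrightarrow> u ! (i + k) \<noteq> 0)}"

definition gaps :: "int list \<Rightarrow> nat set" where
  "gaps u = {k + 1 | i k. (i, k) \<in> gapblocks u}"

definition g1 :: "int list \<Rightarrow> nat" where
  "g1 u = Max (gaps u)"

definition g2 :: "int list \<Rightarrow> nat" where
  "g2 u = Max (gaps u - {g1 u})"

definition num_gaps_located :: "int list \<Rightarrow> nat \<Rightarrow> nat \<Rightarrow> nat \<Rightarrow> nat" where
  "num_gaps_located u g j t =
     card {(i, k) \<in> gapblocks u. k + 1 = g \<and> {i..<i + k} \<subseteq> {j..t}}"


text \<open>The product over the primitive roots of unity has integer coefficients.\<close>

lemma finite_primitive_roots: "n > 0 \<Longrightarrow> finite (primitive_roots n)"
  by (rule finite_subset[OF _ finite_roots_unity[of n]]) (auto simp: primitive_roots_def)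

lemma primitive_roots_disjoint:
  assumes "0 < d" "0 < e" "d \<noteq> e"
  shows "primitive_roots d \<inter> primitive_roots e = {}"
proof -
  have "primitive_roots a \<inter> primitive_roots b = {}" if "0 < a" "a < b" for a b
    using that by (auto simp: primitive_roots_def)
  then show ?thesis
    using assms by (metis inf_commute linorder_neqE_nat)
qed

lemma roots_unity_eq_Union:
  assumes "n > 0"
  shows "{z::complex. z ^ n = 1} = (\<Union>d\<in>{d. d dvd n}. primitive_roots d)"
proof (intro equalityI subsetI)
  fix z :: complex assume "z \<in> {z. z ^ n = 1}"
  then have z: "z ^ n = 1" by simp
  define d where "d = (LEAST k. 0 < k \<and> z ^ k = 1)"
  have d: "0 < d" "z ^ d = 1"
    using LeastI[of "\<lambda>k. 0 < k \<and> z ^ k = 1" n] z assms by (auto simp: d_def)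
  have min: "z ^ k \<noteq> 1" if "0 < k" "k < d" for k
    using not_less_Least[of k "\<lambda>k. 0 < k \<and> z ^ k = 1"] that by (auto simp: d_def)
  have "z ^ n = (z ^ d) ^ (n div d) * z ^ (n mod d)"
    by (simp flip: power_mult power_add)
  then have "z ^ (n mod d) = 1"
    using z d by simp
  then have "n mod d = 0"
    using min[of "n mod d"] d by auto
  then show "z \<in> (\<Union>d\<in>{d. d dvd n}. primitive_roots d)"
    using d min by (auto simp: primitive_roots_def)
next
  fix z :: complex assume "z \<in> (\<Union>d\<in>{d. d dvd n}. primitive_roots d)"
  then show "z \<in> {z. z ^ n = 1}"
    by (auto simp: primitive_roots_def power_mult elim!: dvdE)
qed

lemma prod_roots_unity:
  assumes "n > 0"
  shows "(\<Prod>z | z ^ n = 1. [:- z, 1:]) = monom (1::complex) n - 1"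
proof -
  let ?S = "{z::complex. z ^ n = 1}"
  let ?P = "\<Prod>z\<in>?S. [:- z, 1:]" and ?Q = "monom (1::complex) n - 1"
  have fin: "finite ?S" using assms by (intro finite_roots_unity) auto
  have card: "card ?S = n" using assms by (rule card_roots_unity_eq)
  have degP: "degree ?P = n"
    using fin card by (subst degree_prod_eq_sum_degree) auto
  have degQ: "degree ?Q \<le> n"
    by (intro degree_diff_le degree_monom_le) simp
  have lcP: "lead_coeff ?P = 1"
    by (simp add: lead_coeff_prod)
  have "coeff ?Q n = 1" using assms by simp
  then have cz: "coeff (?P - ?Q) n = 0" using lcP degP by simp
  have "degree (?P - ?Q) \<le> n"
    using degree_diff_le[of ?P n ?Q] degP degQ by simp
  with cz have deg: "degree (?P - ?Q) < n \<or> ?P - ?Q = 0"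
    by (metis le_neq_implies_less leading_coeff_0_iff)
  have "?P - ?Q = 0"
  proof (rule ccontr)
    assume ne: "?P - ?Q \<noteq> 0"
    have "?S \<subseteq> {z. poly (?P - ?Q) z = 0}"
    proof
      fix z assume z: "z \<in> ?S"
      then have "poly ?P z = 0"
        using fin by (subst poly_prod) (auto simp: prod_zero_iff)
      then show "z \<in> {z. poly (?P - ?Q) z = 0}"
        using z by (simp add: poly_monom)
    qed
    then have "n \<le> card {z. poly (?P - ?Q) z = 0}"
      using card card_mono[OF poly_roots_finite[OF ne]] by metis
    also have "\<dots> \<le> degree (?P - ?Q)"
      using ne by (rule card_poly_roots_bound)
    finally show False using deg ne by auto
  qed
  then show ?thesis by simp
qed

lemma coeff_mult_Ints:
  fixes P Q :: "complex poly"
  assumes "\<And>i. coeff P i \<in> \<int>" "\<And>i. coeff Q i \<in> \<int>"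
  shows "coeff (P * Q) i \<in> \<int>"
  using assms by (auto simp: coeff_mult intro!: Ints_sum Ints_mult)

lemma coeff_prod_Ints:
  fixes P :: "'a \<Rightarrow> complex poly"
  assumes "\<And>x i. x \<in> A \<Longrightarrow> coeff (P x) i \<in> \<int>"
  shows "coeff (\<Prod>x\<in>A. P x) i \<in> \<int>"
  using assms
proof (induction A arbitrary: i rule: infinite_finite_induct)
  case (insert x A)
  then show ?case by (auto intro!: coeff_mult_Ints)
qed (auto simp: coeff_1)

lemma coeff_quotient_Ints:
  fixes Q D :: "complex poly"
  assumes PZ: "\<And>i. coeff (Q * D) i \<in> \<int>" and DZ: "\<And>i. coeff D i \<in> \<int>"
    and monic: "lead_coeff D = 1"
  shows "coeff Q k \<in> \<int>"
proof (induction "degree Q - k" arbitrary: k rule: less_induct)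
  case less
  show ?case
  proof (cases "k \<le> degree Q")
    case False
    then show ?thesis by (simp add: coeff_eq_0)
  next
    case True
    let ?d = "degree D"
    let ?f = "\<lambda>i. coeff Q i * coeff D (k + ?d - i)"
    have "coeff (Q * D) (k + ?d) = (\<Sum>i\<le>k + ?d. ?f i)"
      by (simp add: coeff_mult)
    also have "\<dots> = ?f k + (\<Sum>i\<in>{..k + ?d} - {k}. ?f i)"
      by (subst sum.remove[of _ k]) auto
    finally have eq: "coeff Q k = coeff (Q * D) (k + ?d) - (\<Sum>i\<in>{..k + ?d} - {k}. ?f i)"
      using monic by simp
    have "(\<Sum>i\<in>{..k + ?d} - {k}. ?f i) \<in> \<int>"
    proof (rule Ints_sum)
      fix i assume i: "i \<in> {..k + ?d} - {k}"
      consider "i < k" | "i > k" "i \<le> degree Q" | "i > degree Q"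
        using i by force
      then show "?f i \<in> \<int>"
      proof cases
        case 1
        then show ?thesis by (simp add: coeff_eq_0)
      next
        case 2
        then have "coeff Q i \<in> \<int>" by (intro less) auto
        then show ?thesis using DZ by (intro Ints_mult)
      next
        case 3
        then show ?thesis by (simp add: coeff_eq_0)
      qed
    qed
    then show ?thesis using eq PZ by (metis Ints_diff)
  qed
qed

lemma coeff_prod_primitive_roots_Ints:
  assumes "n > 0"
  shows "coeff (\<Prod>z\<in>primitive_roots n. [:- z, 1:]) k \<in> \<int>"
  using assms
proof (induction n arbitrary: k rule: less_induct)
  case (less n)
  let ?F = "\<lambda>d. \<Prod>z\<in>primitive_roots d. [:- z, 1:]"
  let ?D = "\<Prod>d | d dvd n \<and> d \<noteq> n. ?F d"
  have pos: "0 < d" if "d dvd n" for d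
    using that less.prems by (rule dvd_pos_nat[rotated])
  have fin: "finite {d. d dvd n}"
    using less.prems by simp
  have "monom 1 n - 1 = (\<Prod>z\<in>(\<Union>d\<in>{d. d dvd n}. primitive_roots d). [:- z, 1:])"
    using prod_roots_unity[OF less.prems] roots_unity_eq_Union[OF less.prems] by simp
  also have "\<dots> = (\<Prod>d | d dvd n. ?F d)"
    using fin pos finite_primitive_roots primitive_roots_disjoint
    by (intro prod.UNION_disjoint) auto
  also have "\<dots> = ?F n * ?D"
  proof -
    have "{d. d dvd n} - {n} = {d. d dvd n \<and> d \<noteq> n}" by auto
    then show ?thesis using fin by (subst prod.remove[of _ n]) auto
  qed
  finally have eq: "?F n * ?D = monom 1 n - 1" ..
  have "coeff ?D i \<in> \<int>" for i
  proof (rule coeff_prod_Ints)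
    fix d j assume "d \<in> {d. d dvd n \<and> d \<noteq> n}"
    then show "coeff (?F d) j \<in> \<int>"
      using pos less.prems by (intro less.IH) (auto dest: dvd_imp_le)
  qed
  moreover have "lead_coeff ?D = 1"
    by (simp add: lead_coeff_prod)
  moreover have "coeff (?F n * ?D) i \<in> \<int>" for i
    unfolding eq by (simp add: coeff_1)
  ultimately show ?case
    using coeff_quotient_Ints by blast
qed

lemma of_int_cyclotomic:
  assumes "n > 0"
  shows "map_poly of_int (cyclotomic n) = (\<Prod>z\<in>primitive_roots n. [:- z, 1:])"
proof -
  let ?F = "\<Prod>z\<in>primitive_roots n. [:- z, 1:]"
  define P where "P = map_poly (\<lambda>c::complex. \<lfloor>Re c\<rfloor>) ?F"
  have P: "?F = map_poly of_int P"
  proof (rule poly_eqI)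
    fix i
    have "coeff ?F i \<in> \<int>" using coeff_prod_primitive_roots_Ints[OF assms] .
    then show "coeff ?F i = coeff (map_poly of_int P) i"
      by (auto simp: P_def coeff_map_poly elim!: Ints_cases)
  qed
  show ?thesis
    unfolding cyclotomic_def
  proof (rule theI[of _ P])
    show "map_poly of_int P = (\<Prod>z\<in>primitive_roots n. [:- z, 1:])"
      using P by simp
    show "P' = P" if "map_poly of_int P' = (\<Prod>z\<in>primitive_roots n. [:- z, 1:])" for P'
    proof (rule poly_eqI)
      fix i
      have "map_poly (of_int :: int \<Rightarrow> complex) P' = map_poly of_int P" using that P by simp
      then have "coeff (map_poly (of_int :: int \<Rightarrow> complex) P') i = coeff (map_poly of_int P) i"
        by simp
      then show "coeff P' i = coeff P i" by (simp add: coeff_map_poly)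
    qed
  qed
qed

end

theory Submission
  imports Defs "HOL-Number_Theory.Cong"
begin

text \<open>
  Let \<open>S\<close> be the numerical semigroup generated by \<open>p\<close> and \<open>q\<close>. Comparing
  \<open>\<Phi>\<^sub>p\<^sub>q(X) (X\<^sup>p - 1) (X\<^sup>q - 1) = (X\<^sup>p\<^sup>q - 1) (X - 1)\<close> with the Apery set of \<open>S\<close>
  shows that \<open>\<Phi>\<^sub>p\<^sub>q\<close> is \<open>1 - X\<close> times the generating function of \<open>S\<close>
  (\<open>coeff_cyclotomic_pq\<close>). The \<open>j\<close>-th letter of the cyclotomic word is therefore the
  indicator of \<open>j \<in> S\<close> minus that of \<open>j - 1 \<in> S\<close>, and it vanishes exactly where
  membership in \<open>S\<close> does not change. So the gaps of the word are the lengths, at least 2, of the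
  maximal intervals inside \<open>{0..<m}\<close> on which membership is constant.

  The semigroup is symmetric: of two numbers with sum \<open>m - 1\<close> exactly one is a member
  (\<open>S_symmetric\<close>). Hence the word is a palindrome, runs of members are mirror images of
  runs of nonmembers, and it suffices to study the latter, the intervals between consecutive
  members.

  Write \<open>q = K p + r\<close> and take a member \<open>s = x p + y q\<close>. The next member is at most
  \<open>s + p\<close>, which bounds every gap by \<open>p - 1\<close>. If \<open>y \<ge> 1\<close>, then
  \<open>s + (p - r) = (x + K + 1) p + (y - 1) q\<close> is a member; if \<open>y = 0\<close> and
  \<open>x \<ge> K\<close>, then \<open>s + r = (x - K) p + q\<close> is one. The only remaining members are
  \<open>x p\<close> with \<open>x < K\<close>, and below \<open>q\<close> the members are just the multiples of
  \<open>p\<close>, so there the gap is exactly \<open>p - 1\<close>. Thus every other gap is at most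
  \<open>max (r - 1) (p - r - 1)\<close> (\<open>hole_run_cases\<close>). Between \<open>q\<close> and
  \<open>2 q\<close> the members are the numbers congruent to \<open>0\<close> or \<open>r\<close> modulo
  \<open>p\<close>, so both \<open>r - 1\<close> and \<open>p - r - 1\<close> occur \<open>K\<close> times there
  (\<open>hole_run_residue_0\<close>, \<open>hole_run_residue_r\<close>). The counts at the right end of the
  word follow from the palindrome property.
\<close>

section \<open>Gapblocks of reversed words\<close>

lemma finite_gapblocks: "finite (gapblocks u)"
  by (rule finite_subset[of _ "{..length u} \<times> {..length u}"]) (auto simp: gapblocks_def)

lemma finite_gaps: "finite (gaps u)"
proof -
  have "gaps u = (\<lambda>(i, k). k + 1) ` gapblocks u" by (auto simp: gaps_def image_iff)
  then show ?thesis using finite_gapblocks by simp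
qed

lemma gapblocks_length: "(i, k) \<in> gapblocks u \<Longrightarrow> i + k \<le> length u"
  by (simp add: gapblocks_def)

lemma num_gaps_located_mono:
  assumes "{j..t} \<subseteq> {j'..t'}"
  shows "num_gaps_located u g j t \<le> num_gaps_located u g j' t'"
  unfolding num_gaps_located_def
proof (rule card_mono)
  show "finite {(i, k). (i, k) \<in> gapblocks u \<and> k + 1 = g \<and> {i..<i + k} \<subseteq> {j'..t'}}"
    by (rule finite_subset[OF _ finite_gapblocks[of u]]) auto
qed (use assms in blast)

lemma gapblocks_revI:
  assumes "(i, k) \<in> gapblocks u"
  shows "(length u - i - k, k) \<in> gapblocks (rev u)"
proof -
  let ?n = "length u"
  have k: "k \<ge> 1" "i + k \<le> ?n" and z: "\<And>j. i \<le> j \<Longrightarrow> j < i + k \<Longrightarrow> u ! j = 0"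
    and l: "i > 0 \<Longrightarrow> u ! (i - 1) \<noteq> 0" and r: "i + k < ?n \<Longrightarrow> u ! (i + k) \<noteq> 0"
    using assms by (auto simp: gapblocks_def)
  have "rev u ! j = 0" if "?n - i - k \<le> j" "j < ?n - i - k + k" for j
    using that k z[of "?n - Suc j"] by (simp add: rev_nth)
  moreover have "rev u ! (?n - i - k - 1) \<noteq> 0" if "?n - i - k > 0"
  proof -
    have "?n - Suc (?n - i - k - 1) = i + k" using that by linarith
    then show ?thesis using that r by (simp add: rev_nth)
  qed
  moreover have "rev u ! (?n - i - k + k) \<noteq> 0" if "?n - i - k + k < ?n"
  proof -
    have "?n - Suc (?n - i - k + k) = i - 1" "i > 0" using that k by linarith+
    then show ?thesis using that l by (simp add: rev_nth)
  qed
  ultimately show ?thesis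
    using k unfolding gapblocks_def by auto
qed

lemma num_gaps_located_rev_le:
  assumes "j \<le> t" "t < length u"
  shows "num_gaps_located u g j t
    \<le> num_gaps_located (rev u) g (length u - 1 - t) (length u - 1 - j)"
  unfolding num_gaps_located_def
proof (rule card_inj_on_le[where f = "\<lambda>(i, k). (length u - i - k, k)"])
  show "inj_on (\<lambda>(i, k). (length u - i - k, k))
     {(i, k). (i, k) \<in> gapblocks u \<and> k + 1 = g \<and> {i..<i + k} \<subseteq> {j..t}}"
    by (auto simp: inj_on_def dest!: gapblocks_length)
  show "(\<lambda>(i, k). (length u - i - k, k)) `
     {(i, k). (i, k) \<in> gapblocks u \<and> k + 1 = g \<and> {i..<i + k} \<subseteq> {j..t}}
     \<subseteq> {(i, k). (i, k) \<in> gapblocks (rev u) \<and> k + 1 = g \<and>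
          {i..<i + k} \<subseteq> {length u - 1 - t..length u - 1 - j}}"
    (is "_ \<subseteq> ?B")
  proof
    fix b assume "b \<in> (\<lambda>(i, k). (length u - i - k, k)) `
     {(i, k). (i, k) \<in> gapblocks u \<and> k + 1 = g \<and> {i..<i + k} \<subseteq> {j..t}}"
    then obtain i k where b: "b = (length u - i - k, k)" "k + 1 = g"
      and ik: "(i, k) \<in> gapblocks u" and sub: "{i..<i + k} \<subseteq> {j..t}" by auto
    have "(length u - i - k, k) \<in> gapblocks (rev u)" using ik by (rule gapblocks_revI)
    moreover have k: "k \<ge> 1" "i + k \<le> length u" using ik by (auto simp: gapblocks_def)
    have "i \<in> {j..t}" "i + k - 1 \<in> {j..t}" using sub k by (auto simp: subset_iff)
    then have "{length u - i - k..<length u - i - k + k} \<subseteq> {length u - 1 - t..length u - 1 - j}"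
      using k assms by auto
    ultimately show "b \<in> ?B" using b by blast
  qed
  show "finite {(i, k). (i, k) \<in> gapblocks (rev u) \<and> k + 1 = g \<and>
          {i..<i + k} \<subseteq> {length u - 1 - t..length u - 1 - j}}"
    by (rule finite_subset[OF _ finite_gapblocks[of "rev u"]]) auto
qed

lemma num_gaps_located_rev:
  assumes "j \<le> t" "t < length u"
  shows "num_gaps_located (rev u) g (length u - 1 - t) (length u - 1 - j)
    = num_gaps_located u g j t"
proof (rule antisym)
  show "num_gaps_located u g j t
    \<le> num_gaps_located (rev u) g (length u - 1 - t) (length u - 1 - j)"
    using assms by (rule num_gaps_located_rev_le)
  show "num_gaps_located (rev u) g (length u - 1 - t) (length u - 1 - j)
    \<le> num_gaps_located u g j t"
    using num_gaps_located_rev_le[of "length u - 1 - t" "length u - 1 - j" "rev u" g] assms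
    by auto
qed

section \<open>Numerical semigroups with two generators\<close>

definition semigroup2 :: "nat \<Rightarrow> nat \<Rightarrow> nat set" where
  "semigroup2 p q = {x * p + y * q | x y. True}"

locale coprime_pair =
  fixes p q :: nat
  assumes cop: "coprime p q" and p_gt_1: "1 < p" and p_less_q: "p < q"
begin

abbreviation "S \<equiv> semigroup2 p q"

lemma S_I: "n = x * p + y * q \<Longrightarrow> n \<in> S"
  by (auto simp: semigroup2_def)

lemma S_E:
  assumes "n \<in> S"
  obtains x y where "n = x * p + y * q" "y < p"
proof -
  obtain x y where n: "n = x * p + y * q" using assms by (auto simp: semigroup2_def)
  have "n = (x + (y div p) * q) * p + (y mod p) * q"
    by (subst n, subst div_mult_mod_eq[of y p, symmetric]) (simp only: algebra_simps)
  then show ?thesis using that p_gt_1 by (metis mod_less_divisor gr0I not_less_zero)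
qed

lemma S_add_p: "n \<in> S \<Longrightarrow> n + p \<in> S"
  by (auto simp: semigroup2_def) (metis add.assoc add.commute mult_Suc)

lemma residue_exists: "\<exists>y<p. [y * q = n] (mod p)"
proof -
  obtain c where "[q * c = Suc 0] (mod p)"
    using cong_solve_coprime_nat[of q p] cop by (auto simp: coprime_commute)
  then have "[q * c * n = Suc 0 * n] (mod p)" by (rule cong_scalar_right)
  then have "[(c * n) mod p * q = n] (mod p)" by (simp add: cong_def mod_simps mult_ac)
  moreover have "(c * n) mod p < p" using p_gt_1 by simp
  ultimately show ?thesis by blast
qed

lemma residue_unique: "[y * q = y' * q] (mod p) \<Longrightarrow> y < p \<Longrightarrow> y' < p \<Longrightarrow> y = y'"
  using cop by (metis cong_less_modulus_unique_nat cong_mult_rcancel_nat coprime_commute)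

text \<open>
  For each residue class modulo \<open>p\<close> the least member of the semigroup is a multiple
  \<open>y * q\<close>: these numbers form the Apery set of the semigroup with respect to \<open>p\<close>. It gives
  the generating function of the semigroup in closed form.
\<close>

lemma apery:
  "n \<in> S \<and> \<not> (p \<le> n \<and> n - p \<in> S) \<longleftrightarrow> (\<exists>y<p. n = y * q)"
proof
  assume L: "n \<in> S \<and> \<not> (p \<le> n \<and> n - p \<in> S)"
  then obtain x y where n: "n = x * p + y * q" "y < p" using S_E by blast
  have "x = 0"
  proof (rule ccontr)
    assume "x \<noteq> 0"
    then obtain x' where "x = Suc x'" by (cases x) auto
    then have "p \<le> n" "n - p = x' * p + y * q" using n by auto
    then show False using L S_I by blast
  qed
  then show "\<exists>y<p. n = y * q" using n by auto
next
  assume "\<exists>y<p. n = y * q"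
  then obtain y where y: "y < p" "n = y * q" by auto
  have "n \<in> S" using y by (intro S_I[of _ 0 y]) auto
  moreover have False if le: "p \<le> n" and diff: "n - p \<in> S"
  proof -
    obtain x y' where xy: "n - p = x * p + y' * q" "y' < p" using S_E[OF diff] by blast
    have "n = x * p + y' * q + p" using xy(1) le by linarith
    then have *: "y * q = (x + 1) * p + y' * q" using y(2) by simp
    then have "[y * q = y' * q] (mod p)" by (simp only: cong_def mod_mult_self3)
    then have "y = y'" using residue_unique y xy by blast
    with * have "(x + 1) * p = 0" by (simp only: add_cancel_right_left)
    then show False using p_gt_1 by simp
  qed
  ultimately show "n \<in> S \<and> \<not> (p \<le> n \<and> n - p \<in> S)" by blast
qed

abbreviation "m \<equiv> (p - 1) * (q - 1)"

lemma m_eq: "m + p + q = p * q + 1"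
  using p_gt_1 p_less_q by (cases p; cases q) auto

text \<open>
  If both were members, their sum \<open>pq - p - q\<close> would yield \<open>pq = a p + b q\<close> with positive
  \<open>a\<close> and \<open>b\<close>, and \<open>p dvd b\<close> makes the right side too large. If \<open>n\<close> is not a member, it
  lies below the least member \<open>y * q\<close> of its residue class, say \<open>y * q = n + t * p\<close>, and
  then \<open>n' = (t - 1) * p + (p - 1 - y) * q\<close>.
\<close>

lemma S_symmetric:
  assumes "n + n' + 1 = m"
  shows "n \<in> S \<longleftrightarrow> n' \<notin> S"
proof -
  have sum: "n + n' + p + q = p * q" using assms m_eq by linarith
  have "n' \<in> S" if "n \<notin> S"
  proof -
    obtain y where y: "y < p" "[y * q = n] (mod p)" using residue_exists by blast
    have "n < y * q"
    proof (rule ccontr)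
      assume "\<not> n < y * q"
      then obtain x where "n = x * p + y * q"
        using cong_le_nat[of "y * q" n p] cong_sym[OF y(2)] by auto
      then show False using that S_I by blast
    qed
    then obtain t where t: "y * q = t * p + n"
      using cong_le_nat[of n "y * q" p] y(2) by auto
    with \<open>n < y * q\<close> have "t \<noteq> 0" by auto
    then obtain t' where t': "t = Suc t'" by (cases t) auto
    obtain z where z: "p = Suc (y + z)" using y(1) less_imp_Suc_add by blast
    have "p * q = q + y * q + z * q" by (subst z) (simp add: algebra_simps)
    then have "n' = t' * p + z * q" using t t' sum by simp
    then show ?thesis by (rule S_I)
  qed
  moreover have False if nS: "n \<in> S" and n'S: "n' \<in> S"
  proof -
    obtain x y where n: "n = x * p + y * q" using S_E[OF nS] by blast
    obtain x' y' where n': "n' = x' * p + y' * q" using S_E[OF n'S] by blast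
    have *: "(x + x' + 1) * p + (y + y' + 1) * q = p * q" using sum n n' by (simp add: algebra_simps)
    have "p dvd (y + y' + 1) * q" using * by (metis dvd_add_right_iff dvd_triv_left dvd_triv_right)
    then have "p dvd y + y' + 1" using cop coprime_dvd_mult_left_iff by blast
    then have "p \<le> y + y' + 1" by (intro dvd_imp_le) auto
    then have "p * q \<le> (y + y' + 1) * q" by (rule mult_le_mono1)
    moreover have "(x + x' + 1) * p > 0" using p_gt_1 by simp
    ultimately show False using * by linarith
  qed
  ultimately show ?thesis by blast
qed

lemma zero_in_S: "0 \<in> S" by (rule S_I[of _ 0 0]) simp

lemma m_in_S: "m \<in> S"
proof -
  obtain y where y: "y < p" "[y * q = m] (mod p)" using residue_exists by blast
  have "y * q \<le> m"
  proof (rule ccontr)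
    assume "\<not> y * q \<le> m"
    then obtain t where t: "y * q = t * p + m"
      using cong_le_nat[of m "y * q" p] y(2) by auto
    with \<open>\<not> y * q \<le> m\<close> have "t \<noteq> 0" by auto
    then have "p \<le> t * p" by simp
    moreover have "y * q + q \<le> p * q" using y(1) by (metis Suc_leI add.commute mult_Suc mult_le_mono1)
    ultimately show False using t m_eq by linarith
  qed
  then obtain x where "m = x * p + y * q"
    using cong_le_nat[of "y * q" m p] cong_sym[OF y(2)] by auto
  then show ?thesis by (rule S_I)
qed

section \<open>Elements below twice the larger generator\<close>

lemma S_below_q: "n < q \<Longrightarrow> n \<in> S \<longleftrightarrow> p dvd n"
proof
  assume "n < q" "n \<in> S"
  then obtain x y where n: "n = x * p + y * q" using S_E by blast
  with \<open>n < q\<close> have "y = 0" by (cases y) auto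
  then show "p dvd n" using n by simp
next
  assume "p dvd n"
  then obtain x where "n = p * x" by (elim dvdE)
  then show "n \<in> S" by (intro S_I[of _ x 0]) simp
qed

lemma S_below_2q:
  assumes "n < 2 * q" "n \<in> S"
  shows "p dvd n \<or> [n = q] (mod p)"
proof -
  obtain x y where n: "n = x * p + y * q" using assms S_E by blast
  have "y < 2"
  proof (rule ccontr)
    assume "\<not> y < 2"
    then have "2 * q \<le> y * q" by simp
    then show False using n assms by linarith
  qed
  then have "y = 0 \<or> y = 1" by auto
  then show ?thesis using n by (auto simp: cong_def)
qed

section \<open>Runs of nonmembers\<close>

text \<open>
  The members \<open>s\<close> and \<open>s + g + 1\<close> are consecutive. The run is indexed by the member before it,
  since that member decides how long the run can be.
\<close>

definition hole_run :: "nat \<Rightarrow> nat \<Rightarrow> bool" where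
  "hole_run s g \<longleftrightarrow> s \<in> S \<and> s + g + 1 \<in> S \<and> (\<forall>j. s < j \<and> j \<le> s + g \<longrightarrow> j \<notin> S)"

lemma hole_run_le:
  assumes "hole_run s g" "s + d \<in> S" "d > 0"
  shows "g \<le> d - 1"
  using assms unfolding hole_run_def by (metis Suc_diff_1 add_le_cancel_left less_add_same_cancel1 not_less_eq_eq)

lemma hole_run_le_p: "hole_run s g \<Longrightarrow> g \<le> p - 1"
  using hole_run_le[of s g p] S_add_p[of s] p_gt_1 by (auto simp: hole_run_def)

lemma hole_run_multiple:
  assumes "x < q div p"
  shows "hole_run (x * p) (p - 1)"
proof -
  have "x * p + p \<le> q div p * p" using mult_le_mono1[of "x + 1" "q div p" p] assms by simp
  also have "\<dots> \<le> q" by (rule div_times_less_eq_dividend)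
  finally have le: "x * p + p \<le> q" .
  have "j \<notin> S" if j: "x * p < j" "j \<le> x * p + (p - 1)" for j
  proof -
    obtain d where d: "j = x * p + d" "0 < d" using less_imp_add_positive[OF j(1)] by blast
    then have "\<not> p dvd j" using that p_gt_1 by (auto dest: dvd_imp_le)
    then show ?thesis using S_below_q[of j] that le p_gt_1 by auto
  qed
  moreover have "x * p + (p - 1) + 1 = (x + 1) * p" using p_gt_1 by simp
  moreover have "x * p \<in> S" by (rule S_I[of _ x 0]) simp
  moreover have "(x + 1) * p \<in> S" by (rule S_I[of _ "x + 1" 0]) simp
  ultimately show ?thesis unfolding hole_run_def by metis
qed

text \<open>
  The representation \<open>s = x * p + y * q\<close> exhibits a later member. If \<open>y > 0\<close>, one \<open>q\<close> can be
  exchanged for \<open>q div p + 1\<close> copies of \<open>p\<close>, which adds \<open>p - q mod p\<close>; if \<open>x \<ge> q div p\<close>, then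
  \<open>q div p\<close> copies of \<open>p\<close> can be exchanged for one \<open>q\<close>, which adds \<open>q mod p\<close>. Only the first
  few multiples of \<open>p\<close> allow neither exchange.
\<close>

lemma hole_run_cases:
  assumes "hole_run s g"
  obtains x where "x < q div p" "s = x * p" "g = p - 1"
  | "g \<le> q mod p - 1" | "g \<le> p - q mod p - 1"
proof -
  define K r where "K = q div p" and "r = q mod p"
  have q: "q = K * p + r" by (simp add: K_def r_def)
  have r: "r < p" using p_gt_1 by (simp add: r_def)
  have r0: "r > 0" unfolding r_def using cop p_gt_1
    by (auto intro!: gr0I dest: mod_0_imp_dvd simp: coprime_absorb_left)
  have "s \<in> S" using assms unfolding hole_run_def by blast
  then obtain x y where s: "s = x * p + y * q" by (rule S_E)
  show ?thesis
  proof (cases y)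
    case (Suc y')
    have "s + (p - r) = (x + K + 1) * p + y' * q"
      using s Suc q r by (simp add: algebra_simps)
    then have "s + (p - r) \<in> S" by (rule S_I)
    then have "g \<le> p - r - 1" by (rule hole_run_le[OF assms]) (use r in simp)
    then show ?thesis using that unfolding r_def by blast
  next
    case 0
    show ?thesis
    proof (cases "x < K")
      case True
      have h: "hole_run s (p - 1)" using hole_run_multiple True s 0 unfolding K_def by simp
      have "g \<le> p - 1" using hole_run_le_p assms by blast
      moreover have "p - 1 \<le> g"
        using hole_run_le[OF h, of "g + 1"] assms unfolding hole_run_def by (simp add: add.assoc)
      ultimately show ?thesis using that True s 0 unfolding K_def by auto
    next
      case False
      then obtain e where e: "x = K + e" using le_Suc_ex not_less by blast
      have "s + r = e * p + 1 * q"
        using s 0 q unfolding e by (simp add: algebra_simps)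
      then have "s + r \<in> S" by (rule S_I)
      then have "g \<le> r - 1" using hole_run_le[OF assms] r0 by simp
      then show ?thesis using that unfolding r_def by blast
    qed
  qed
qed

text \<open>
  From \<open>q + x * p\<close> up to the next multiple of \<open>p\<close>: the residues modulo \<open>p\<close> in between
  exceed \<open>q mod p\<close>, while members below \<open>2 * q\<close> have residue \<open>0\<close> or \<open>q mod p\<close>.
\<close>

lemma hole_run_residue_r:
  assumes "x < q div p"
  shows "hole_run (q + x * p) (p - q mod p - 1)"
proof -
  define K r where "K = q div p" and "r = q mod p"
  have q: "q = K * p + r" by (simp add: K_def r_def)
  have r: "r < p"
    using assms p_gt_1 unfolding r_def by simp_all
  have x: "x * p + p \<le> K * p"
    using mult_le_mono1[of "x + 1" K p] assms unfolding K_def by simp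
  have "j \<notin> S" if j: "q + x * p < j" "j \<le> q + x * p + (p - r - 1)" for j
  proof -
    obtain d where d: "j = q + x * p + d" "0 < d" using less_imp_add_positive[OF j(1)] by blast
    have "r + d < p" using that d r by linarith
    have "j = (K + x) * p + (r + d)" using d q by (simp add: algebra_simps)
    then have "j mod p = r + d" using \<open>r + d < p\<close> by (simp only: mod_mult_self3 mod_less)
    then have "\<not> p dvd j" "\<not> [j = q] (mod p)"
      using d(2) unfolding cong_def dvd_eq_mod_eq_0 r_def by auto
    moreover have "j < 2 * q"
    proof -
      have "j < q + (x * p + p)" using that r by linarith
      then show ?thesis using x q by linarith
    qed
    ultimately show ?thesis using S_below_2q by blast
  qed
  moreover have "q + x * p + (p - r - 1) + 1 = (K + x + 1) * p" using q r by (simp add: algebra_simps)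
  moreover have "q + x * p \<in> S" by (rule S_I[of _ x 1]) simp
  moreover have "(K + x + 1) * p \<in> S" by (rule S_I[of _ "K + x + 1" 0]) simp
  ultimately show ?thesis unfolding hole_run_def r_def by auto
qed

text \<open>
  From a multiple of \<open>p\<close> above \<open>q\<close> up to the next number congruent to \<open>q\<close>: the residues
  in between lie strictly between \<open>0\<close> and \<open>q mod p\<close>.
\<close>

lemma hole_run_residue_0:
  assumes "x < q div p" "0 < q mod p"
  shows "hole_run ((q div p + 1 + x) * p) (q mod p - 1)"
proof -
  define K r where "K = q div p" and "r = q mod p"
  have q: "q = K * p + r" by (simp add: K_def r_def)
  have r: "r < p" and r0: "0 < r"
    using assms p_gt_1 unfolding r_def by simp_all
  have x: "x * p + p \<le> K * p"
    using mult_le_mono1[of "x + 1" K p] assms unfolding K_def by simp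
  have "j \<notin> S" if j: "(K + 1 + x) * p < j" "j \<le> (K + 1 + x) * p + (r - 1)" for j
  proof -
    obtain d where d: "j = (K + 1 + x) * p + d" "0 < d" using less_imp_add_positive[OF j(1)] by blast
    have "d < r" "d < p" using that d r0 r by linarith+
    then have "j mod p = d" using d(1) \<open>d < p\<close> by (simp only: mod_mult_self3 mod_less)
    then have "\<not> p dvd j" "\<not> [j = q] (mod p)"
      using d(2) \<open>d < r\<close> unfolding cong_def dvd_eq_mod_eq_0 r_def by auto
    moreover have "j < 2 * q"
    proof -
      have "j < K * p + (x * p + p) + r" using that r0 by (simp add: algebra_simps)
      then show ?thesis using x q by linarith
    qed
    ultimately show ?thesis using S_below_2q by blast
  qed
  moreover have "(K + 1 + x) * p + (r - 1) + 1 = (x + 1) * p + 1 * q"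
    using q r0 by (simp add: algebra_simps)
  moreover have "(x + 1) * p + 1 * q \<in> S" by (rule S_I) (rule refl)
  moreover have "(K + 1 + x) * p \<in> S" by (rule S_I[of _ "K + 1 + x" 0]) simp
  ultimately show ?thesis unfolding hole_run_def r_def K_def by metis
qed

section \<open>The difference word of the semigroup\<close>

text \<open>
  The coefficients up to \<open>X\<^sup>m\<close> of \<open>1 - X\<close> times the generating function of the semigroup.
  The guard \<open>0 < j\<close> is needed because \<open>0 - 1 = 0\<close> on natural numbers and \<open>0\<close> is a member.
\<close>

definition diff_word :: "int list" where
  "diff_word = map (\<lambda>j. of_bool (j \<in> S) - of_bool (0 < j \<and> j - 1 \<in> S)) [0..<m + 1]"

lemma length_diff_word [simp]: "length diff_word = m + 1"
  by (simp add: diff_word_def)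

lemma nth_diff_word: "j \<le> m \<Longrightarrow> diff_word ! j = of_bool (j \<in> S) - of_bool (0 < j \<and> j - 1 \<in> S)"
  by (simp add: diff_word_def del: upt_Suc)

lemma nth_diff_word_eq_0_iff:
  "0 < j \<Longrightarrow> j \<le> m \<Longrightarrow> diff_word ! j = 0 \<longleftrightarrow> (j \<in> S \<longleftrightarrow> j - 1 \<in> S)"
  by (simp add: nth_diff_word)

lemma m_pos: "0 < m"
  using p_gt_1 p_less_q by simp

lemma m_minus_1_notin_S: "m - 1 \<notin> S"
  using S_symmetric[of 0 "m - 1"] zero_in_S m_pos by simp

lemma nth_diff_word_0: "diff_word ! 0 = 1" and nth_diff_word_m: "diff_word ! m = 1"
  using m_pos m_in_S m_minus_1_notin_S zero_in_S nth_diff_word[of 0] nth_diff_word[of m] by auto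

text \<open>
  Reflection exchanges members and nonmembers by \<open>S_symmetric\<close> and also reverses the order of
  \<open>j - 1\<close> and \<open>j\<close>, so the two sign changes in the difference cancel.
\<close>

lemma rev_diff_word: "rev diff_word = diff_word"
proof (rule nth_equalityI)
  fix j assume "j < length (rev diff_word)"
  then have j: "j \<le> m" by simp
  have "diff_word ! (m - j) = diff_word ! j"
  proof (cases "j = 0 \<or> j = m")
    case True
    then show ?thesis using nth_diff_word_0 nth_diff_word_m by auto
  next
    case False
    then have "0 < j" "j < m" using j by auto
    then have "diff_word ! j = of_bool (j \<in> S) - of_bool (j - 1 \<in> S)"
      and "diff_word ! (m - j) = of_bool (m - j \<in> S) - of_bool (m - j - 1 \<in> S)"
      using nth_diff_word[of j] nth_diff_word[of "m - j"] by auto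
    moreover have "j \<in> S \<longleftrightarrow> m - j - 1 \<notin> S" "j - 1 \<in> S \<longleftrightarrow> m - j \<notin> S"
      using \<open>0 < j\<close> \<open>j < m\<close> by (intro S_symmetric; linarith)+
    ultimately show ?thesis by auto
  qed
  then show "rev diff_word ! j = diff_word ! j" using j by (simp add: rev_nth)
qed simp

text \<open>
  A run of zeros at \<open>i, \<dots>, i + k - 1\<close> means that membership is constant on the \<open>k + 1\<close>
  positions \<open>i - 1, \<dots>, i + k - 1\<close>; this is why a gap is the length of its gapblock plus one.
  The first and the last letter are nonzero, so no gapblock touches an end of the word.
\<close>

lemma gapblock_diff_word:
  assumes "(i, k) \<in> gapblocks diff_word"
  shows "1 \<le> k" "1 \<le> i" "i + k \<le> m"
    and "i - 1 \<le> j \<Longrightarrow> j < i + k \<Longrightarrow> j \<in> S \<longleftrightarrow> i - 1 \<in> S"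
proof -
  have k: "1 \<le> k" "i + k \<le> m + 1" and z: "\<And>j. i \<le> j \<Longrightarrow> j < i + k \<Longrightarrow> diff_word ! j = 0"
    using assms by (auto simp: gapblocks_def)
  show "1 \<le> k" by fact
  show i: "1 \<le> i" using z[of 0] k nth_diff_word_0 by (cases i) auto
  show ik: "i + k \<le> m"
  proof (rule ccontr)
    assume "\<not> i + k \<le> m"
    then show False using z[of m] k nth_diff_word_m by auto
  qed
  assume "i - 1 \<le> j"
  then show "j < i + k \<Longrightarrow> j \<in> S \<longleftrightarrow> i - 1 \<in> S"
  proof (induction j rule: dec_induct)
    case (step j)
    then show ?case using z[of "Suc j"] nth_diff_word_eq_0_iff[of "Suc j"] i ik by auto
  qed simp
qed

text \<open>
  The first nonmember is at \<open>i - 1\<close>, hence the preceding member at \<open>i - 2\<close>.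
\<close>

lemma hole_run_of_gapblock:
  assumes "(i, k) \<in> gapblocks diff_word" "i - 1 \<notin> S"
  shows "\<exists>s. i = s + 2 \<and> hole_run s (k + 1)"
proof -
  note gb = gapblock_diff_word[OF assms(1)]
  have nz: "diff_word ! (i - 1) \<noteq> 0" "diff_word ! (i + k) \<noteq> 0"
    using assms(1) gb(1-3) by (auto simp: gapblocks_def)
  have "i \<noteq> 1" using assms(2) zero_in_S by (metis diff_self_eq_0)
  then obtain s where s: "i = s + 2"
    using gb(2) le_Suc_ex[of 2 i] by auto
  have "s \<in> S" using nz(1) nth_diff_word_eq_0_iff[of "i - 1"] gb(1-3) assms(2) s by auto
  moreover have "i + k \<in> S"
    using nz(2) nth_diff_word_eq_0_iff[of "i + k"] gb(1-3) gb(4)[of "i + k - 1"] assms(2) by auto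
  moreover have "j \<notin> S" if "s < j" "j \<le> s + (k + 1)" for j
    using gb(4)[of j] that s assms(2) by auto
  ultimately show ?thesis unfolding hole_run_def using s by auto
qed

lemma gapblock_of_hole_run:
  assumes "hole_run s g" "2 \<le> g" "s + g + 1 \<le> m"
  shows "(s + 2, g - 1) \<in> gapblocks diff_word"
proof -
  have S: "s \<in> S" "s + g + 1 \<in> S" and nS: "\<And>j. s < j \<Longrightarrow> j \<le> s + g \<Longrightarrow> j \<notin> S"
    using assms(1) unfolding hole_run_def by auto
  have "diff_word ! j = 0" if "s + 2 \<le> j" "j < s + 2 + (g - 1)" for j
    using that assms nS[of j] nS[of "j - 1"] nth_diff_word_eq_0_iff[of j] by auto
  moreover have "diff_word ! (s + 1) \<noteq> 0"
    using assms S(1) nS[of "s + 1"] nth_diff_word_eq_0_iff[of "s + 1"] by auto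
  moreover have "diff_word ! (s + g + 1) \<noteq> 0"
    using assms S(2) nS[of "s + g"] nth_diff_word_eq_0_iff[of "s + g + 1"] by auto
  moreover have "s + 2 + (g - 1) = s + g + 1" "s + 2 - 1 = s + 1" using assms(2) by auto
  ultimately show ?thesis
    using assms unfolding gapblocks_def by auto
qed

text \<open>
  A gapblock over members becomes one over nonmembers, of the same length, when the palindromic
  word is reversed.
\<close>

lemma hole_run_of_gap:
  assumes "g \<in> gaps diff_word"
  shows "2 \<le> g" "\<exists>s. hole_run s g"
proof -
  obtain i k where ik: "(i, k) \<in> gapblocks diff_word" "g = k + 1" using assms by (auto simp: gaps_def)
  note gb = gapblock_diff_word[OF ik(1)]
  show "2 \<le> g" using gb(1) ik by simp
  show "\<exists>s. hole_run s g"
  proof (cases "i - 1 \<in> S")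
    case False
    then show ?thesis using hole_run_of_gapblock ik by blast
  next
    case True
    let ?i = "m + 1 - i - k"
    have "(?i, k) \<in> gapblocks diff_word" using gapblocks_revI[OF ik(1)] rev_diff_word by simp
    moreover have "?i - 1 \<notin> S"
    proof -
      have "i + k - 1 \<in> S" using True gb(1-3) gb(4)[of "i + k - 1"] by auto
      moreover have "(i + k - 1) + (?i - 1) + 1 = m" using gb(1-3) by auto
      ultimately show ?thesis using S_symmetric by blast
    qed
    ultimately show ?thesis using hole_run_of_gapblock ik by blast
  qed
qed

lemma num_gaps_located_hole_runs:
  assumes "2 \<le> g" "t < m" "inj_on s X"
    and "\<And>x. x \<in> X \<Longrightarrow> hole_run (s x) g \<and> j \<le> s x + 2 \<and> s x + g \<le> t"
  shows "card X \<le> num_gaps_located diff_word g j t"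
  unfolding num_gaps_located_def
proof (rule card_inj_on_le[where f = "\<lambda>x. (s x + 2, g - 1)"])
  show "inj_on (\<lambda>x. (s x + 2, g - 1)) X" using assms(3) by (auto simp: inj_on_def)
  show "finite {(i, k). (i, k) \<in> gapblocks diff_word \<and> k + 1 = g \<and> {i..<i + k} \<subseteq> {j..t}}"
    by (rule finite_subset[OF _ finite_gapblocks[of diff_word]]) auto
  show "(\<lambda>x. (s x + 2, g - 1)) ` X
     \<subseteq> {(i, k). (i, k) \<in> gapblocks diff_word \<and> k + 1 = g \<and> {i..<i + k} \<subseteq> {j..t}}"
    using assms gapblock_of_hole_run by fastforce
qed

lemma gap_of_hole_run: "hole_run s g \<Longrightarrow> 2 \<le> g \<Longrightarrow> s + g + 1 \<le> m \<Longrightarrow> g \<in> gaps diff_word"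
  using gapblock_of_hole_run[of s g] unfolding gaps_def
  by (intro CollectI exI[of _ "s + 2"] exI[of _ "g - 1"]) auto

lemma q_le_m: "3 \<le> p \<Longrightarrow> q < m"
  using mult_le_mono1[of 2 "p - 1" "q - 1"] p_less_q by linarith

lemma two_q_le_m: "5 \<le> p \<Longrightarrow> 2 * q < m"
  using mult_le_mono1[of 4 "p - 1" "q - 1"] p_less_q by linarith

lemma div_pos: "0 < q div p"
  using p_gt_1 p_less_q by (simp add: div_greater_zero_iff)

lemma g1_diff_word:
  assumes "3 \<le> p"
  shows "g1 diff_word = p - 1"
  unfolding g1_def
proof (rule Max_eqI)
  show "finite (gaps diff_word)" by (rule finite_gaps)
  show "y \<le> p - 1" if "y \<in> gaps diff_word" for y using hole_run_of_gap[OF that] hole_run_le_p by blast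
  show "p - 1 \<in> gaps diff_word"
    using gap_of_hole_run hole_run_multiple[OF div_pos] assms q_le_m p_less_q by simp
qed

text \<open>
  The members below \<open>q\<close> are multiples of \<open>p\<close>, so no two of them are adjacent and every
  gapblock in this range comes from a run of nonmembers. The last multiple of \<open>p\<close> before \<open>q\<close>
  does not count, since its run is cut off by \<open>q\<close>.
\<close>

lemma gapblocks_diff_word_below_q:
  assumes "3 \<le> p"
  shows "{(i, k). (i, k) \<in> gapblocks diff_word \<and> k + 1 = p - 1 \<and> {i..<i + k} \<subseteq> {0..q - 1}}
    = (\<lambda>x. (x * p + 2, p - 2)) ` {..<q div p}" (is "?L = ?R")
proof (intro equalityI subsetI)
  fix b assume "b \<in> ?R"
  then obtain x where x: "x < q div p" "b = (x * p + 2, p - 2)" by auto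
  have "x * p + p \<le> q div p * p" using mult_le_mono1[of "x + 1" "q div p" p] x by simp
  also have "\<dots> \<le> q" by (rule div_times_less_eq_dividend)
  finally have le: "x * p + p \<le> q" .
  then have "(x * p + 2, p - 1 - 1) \<in> gapblocks diff_word"
    using gapblock_of_hole_run[OF hole_run_multiple[OF x(1)]] assms q_le_m by simp
  then show "b \<in> ?L" using x le assms by (auto simp: numeral_2_eq_2)
next
  fix b assume "b \<in> ?L"
  then obtain i k where b: "b = (i, k)" and ik: "(i, k) \<in> gapblocks diff_word" "k + 1 = p - 1"
    and sub: "{i..<i + k} \<subseteq> {0..q - 1}" by auto
  note gb = gapblock_diff_word[OF ik(1)]
  have "i + k - 1 \<in> {i..<i + k}" using gb(1) by auto
  then have iq: "i + k \<le> q" using sub p_less_q by force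
  have "i - 1 \<notin> S"
  proof
    assume "i - 1 \<in> S"
    moreover from this have "i \<in> S" using gb(1,2) gb(4)[of i] by auto
    ultimately have "p dvd i - 1" "p dvd i"
      using S_below_q[of i] S_below_q[of "i - 1"] iq gb(1,2) by auto
    then have "p dvd 1" using gb(2) by (metis dvd_diff_nat diff_diff_cancel)
    then show False using p_gt_1 by simp
  qed
  then obtain s where s: "i = s + 2" "hole_run s (k + 1)" using hole_run_of_gapblock[OF ik(1)] by blast
  have "p dvd s" using s S_below_q[of s] iq unfolding hole_run_def by auto
  then obtain x where x: "s = x * p" by (metis dvdE mult.commute)
  have "(x + 1) * p \<le> q" using x iq ik s assms by simp
  then have "x < q div p" using p_gt_1 by (metis Suc_eq_plus1 Suc_le_eq less_eq_div_iff_mult_less_eq less_trans zero_less_one)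
  moreover have "b = (x * p + 2, p - 2)" using b x s ik by simp
  ultimately show "b \<in> ?R" by blast
qed

lemma num_gaps_located_diff_word_below_q:
  assumes "3 \<le> p"
  shows "num_gaps_located diff_word (p - 1) 0 (q - 1) = q div p"
  unfolding num_gaps_located_def gapblocks_diff_word_below_q[OF assms] using p_gt_1
  by (subst card_image) (auto simp: inj_on_def)

lemma num_gaps_located_diff_word_mirror:
  assumes "j \<le> t" "t \<le> m"
  shows "num_gaps_located diff_word g (m - t) (m - j) = num_gaps_located diff_word g j t"
proof -
  have len: "length diff_word - 1 = m" and t: "t < length diff_word" using assms(2) by simp_all
  show ?thesis
    using num_gaps_located_rev[OF assms(1) t, of g] unfolding rev_diff_word len .
qed

lemma num_gaps_located_diff_word_right_end:
  assumes "3 \<le> p"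
  shows "num_gaps_located diff_word (p - 1) (m - q + 1) m = q div p"
proof -
  have "m - (q - 1) = m - q + 1" "q - 1 \<le> m"
    using q_le_m[OF assms] p_less_q by linarith+
  then show ?thesis
    using num_gaps_located_diff_word_mirror[of 0 "q - 1" "p - 1"]
      num_gaps_located_diff_word_below_q[OF assms] by (simp only: diff_zero le0)
qed

lemma g2_diff_word:
  assumes "5 \<le> p" "q mod p \<in> {2..p - 2}"
  shows "g2 diff_word = max (q mod p - 1) (p - q mod p - 1)"
    and "q div p \<le> num_gaps_located diff_word (g2 diff_word) q (2 * q - 1)"
    and "q div p \<le> num_gaps_located diff_word (g2 diff_word) (m - 2 * q - 1) (m - q)"
proof -
  define K r where "K = q div p" and "r = q mod p"
  define g where "g = max (r - 1) (p - r - 1)"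
  have r: "2 \<le> r" "r \<le> p - 2" using assms by (auto simp: r_def)
  have g_ge: "r - 1 \<le> g" "p - r - 1 \<le> g" and g_cases: "g = r - 1 \<or> g = p - r - 1"
    by (auto simp: g_def)
  have g: "2 \<le> g" "g \<noteq> p - 1" using r assms(1) g_ge g_cases by linarith+
  have m: "2 * q < m" using two_q_le_m assms(1) .
  have q: "q = K * p + r" by (simp add: K_def r_def)
  \<comment> \<open>the members that precede the runs of length \<open>g\<close>, chosen by which of the two lengths is larger\<close>
  define s where "s x = (if g = r - 1 then (K + 1 + x) * p else q + x * p)" for x
  have inj: "inj_on s {..<K}" using p_gt_1 by (auto simp: inj_on_def s_def)
  have s: "hole_run (s x) g \<and> q \<le> s x + 2 \<and> s x + g \<le> 2 * q - 1" if "x \<in> {..<K}" for x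
  proof -
    have x: "x < q div p" using that by (simp add: K_def)
    have le: "x * p + p \<le> K * p" using mult_le_mono1[of "x + 1" K p] that by simp
    show ?thesis
    proof (cases "g = r - 1")
      case True
      have "s x = (K + 1 + x) * p" unfolding s_def by (rule if_P[OF True])
      moreover have "hole_run ((K + 1 + x) * p) g"
        unfolding True K_def r_def using r by (intro hole_run_residue_0 x) (simp add: r_def)
      moreover have "(K + 1 + x) * p = K * p + p + x * p" by (simp add: algebra_simps)
      ultimately show ?thesis using True le q r by (intro conjI) (simp, linarith+)
    next
      case False
      then have g': "g = p - r - 1" using g_cases by blast
      have "s x = q + x * p" unfolding s_def by (rule if_not_P[OF False])
      moreover have "hole_run (q + x * p) g"
        unfolding g' r_def by (intro hole_run_residue_r x)
      ultimately show ?thesis using g' le q r by (intro conjI) (simp, linarith+)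
    qed
  qed
  have g1: "g1 diff_word = p - 1" using g1_diff_word assms(1) by simp
  have g2: "g2 diff_word = g"
    unfolding g2_def g1
  proof (rule Max_eqI)
    show "finite (gaps diff_word - {p - 1})" using finite_gaps by blast
    show "y \<le> g" if y: "y \<in> gaps diff_word - {p - 1}" for y
    proof -
      obtain s where "hole_run s y" using y hole_run_of_gap by blast
      then show ?thesis by (cases rule: hole_run_cases) (use y g_ge in \<open>auto simp: r_def\<close>)
    qed
    have run: "hole_run (s 0) g" "s 0 + g \<le> 2 * q - 1" using s[of 0] div_pos by (auto simp: K_def)
    then have "s 0 + g + 1 \<le> m" using m by linarith
    with run(1) g(1) have "g \<in> gaps diff_word" by (rule gap_of_hole_run)
    then show "g \<in> gaps diff_word - {p - 1}" using g by blast
  qed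
  then show "g2 diff_word = max (q mod p - 1) (p - q mod p - 1)" by (simp add: g_def r_def)
  have "2 * q - 1 < m" using m by linarith
  then have "card {..<K} \<le> num_gaps_located diff_word g q (2 * q - 1)"
    by (rule num_gaps_located_hole_runs[OF g(1) _ inj s])
  then show left: "q div p \<le> num_gaps_located diff_word (g2 diff_word) q (2 * q - 1)"
    by (simp add: g2 K_def)
  have "q \<le> 2 * q - 1" "m - 2 * q - 1 \<le> m - (2 * q - 1)"
    using p_less_q by linarith+
  \<comment> \<open>The mirror image of \<open>{q..2 * q - 1}\<close> starts at \<open>m - 2 * q + 1\<close>; the stated interval is larger.\<close>
  note left
  also have "num_gaps_located diff_word (g2 diff_word) q (2 * q - 1)
    = num_gaps_located diff_word (g2 diff_word) (m - (2 * q - 1)) (m - q)"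
    using num_gaps_located_diff_word_mirror[of q "2 * q - 1"]
      \<open>q \<le> 2 * q - 1\<close> \<open>2 * q - 1 < m\<close> by (metis less_imp_le)
  also have "\<dots> \<le> num_gaps_located diff_word (g2 diff_word) (m - 2 * q - 1) (m - q)"
    using \<open>m - 2 * q - 1 \<le> m - (2 * q - 1)\<close> by (intro num_gaps_located_mono) simp
  finally show "q div p \<le> num_gaps_located diff_word (g2 diff_word) (m - 2 * q - 1) (m - q)" .
qed

end

section \<open>Coefficients of binary cyclotomic polynomials\<close>

text \<open>
  Multiplying by \<open>1 - X\<^sup>p\<close> leaves only the Apery set \<open>{y * q | y < p}\<close>, and its generating
  function is a geometric sum in \<open>X\<^sup>q\<close>.
\<close>

lemma (in coprime_pair) fps_semigroup:
  fixes I :: "'a::comm_ring_1 fps"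
  defines "I \<equiv> Abs_fps (\<lambda>n. of_bool (n \<in> S))"
  shows "(1 - fps_X ^ q) * ((1 - fps_X ^ p) * I) = 1 - fps_X ^ (p * q)"
proof -
  have "(1 - fps_X ^ p) * I = (\<Sum>y<p. (fps_X ^ q) ^ y)"
  proof (rule fps_ext)
    fix n
    have "((1 - fps_X ^ p) * I) $ n = of_bool (n \<in> S) - of_bool (p \<le> n \<and> n - p \<in> S)"
      by (auto simp: left_diff_distrib fps_X_power_mult_nth I_def)
    also have "\<dots> = of_bool (n \<in> S \<and> \<not> (p \<le> n \<and> n - p \<in> S))"
      using S_add_p[of "n - p"] by auto
    also have "\<dots> = of_bool (\<exists>y<p. n = y * q)" by (simp only: apery)
    also have "\<dots> = (\<Sum>y<p. if n = q * y then 1 else 0)"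
    proof (cases "\<exists>y<p. n = y * q")
      case True
      then obtain y where y: "y < p" "n = y * q" by blast
      then have "(n = q * y') = (y' = y)" for y' using p_less_q by auto
      then show ?thesis using True y by (simp add: sum.delta)
    next
      case False
      then show ?thesis by (auto simp: mult.commute intro!: sum.neutral[symmetric])
    qed
    also have "\<dots> = (\<Sum>y<p. (fps_X ^ q) ^ y) $ n"
      by (simp add: fps_sum_nth flip: power_mult)
    finally show "((1 - fps_X ^ p) * I) $ n = (\<Sum>y<p. (fps_X ^ q) ^ y) $ n" .
  qed
  also have "(1 - fps_X ^ q) * \<dots> = 1 - (fps_X ^ q) ^ p"
    by (rule one_diff_power_eq[symmetric])
  also have "\<dots> = 1 - fps_X ^ (p * q)"
    by (simp add: mult.commute flip: power_mult)
  finally show ?thesis .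
qed

lemma prod_primitive_roots_divisors:
  assumes "n > 0"
  shows "(\<Prod>d | d dvd n. \<Prod>z\<in>primitive_roots d. [:- z, 1:]) = monom (1::complex) n - 1"
proof -
  have pos: "0 < d" if "d dvd n" for d
    using that assms by (rule dvd_pos_nat[rotated])
  have "(\<Prod>z\<in>(\<Union>d\<in>{d. d dvd n}. primitive_roots d). [:- z, 1:])
    = (\<Prod>d | d dvd n. \<Prod>z\<in>primitive_roots d. [:- z, 1:])"
    using assms pos finite_primitive_roots primitive_roots_disjoint
    by (intro prod.UNION_disjoint) auto
  then show ?thesis
    using prod_roots_unity[OF assms] roots_unity_eq_Union[OF assms] by simp
qed

text \<open>
  Write \<open>F\<^sub>d\<close> for the product over the primitive \<open>d\<close>-th roots of unity. The factorisations
  \<open>X\<^sup>p - 1 = F\<^sub>1 F\<^sub>p\<close>, \<open>X\<^sup>q - 1 = F\<^sub>1 F\<^sub>q\<close> and \<open>X\<^sup>p\<^sup>q - 1 = F\<^sub>1 F\<^sub>p F\<^sub>q F\<^sub>p\<^sub>q\<close> make both sides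
  equal to \<open>F\<^sub>1\<^sup>2 F\<^sub>p F\<^sub>q F\<^sub>p\<^sub>q\<close>.
\<close>

lemma cyclotomic_pq_identity:
  fixes p q :: nat
  assumes "prime p" "prime q" "p \<noteq> q"
  shows "map_poly of_int (cyclotomic (p * q)) * (monom (1::complex) p - 1) * (monom 1 q - 1)
    = (monom 1 (p * q) - 1) * (monom 1 1 - 1)"
proof -
  let ?F = "\<lambda>d. \<Prod>z\<in>primitive_roots d. [:- z, 1:]"
  have p1: "p \<noteq> 1" "q \<noteq> 1" "p > 0" "q > 0" using assms by (auto dest: prime_gt_0_nat)
  have pq: "p * q \<noteq> p" "p * q \<noteq> q" "p * q \<noteq> 1" using p1 by auto
  have dp: "{d. d dvd p} = {1, p}" "{d. d dvd q} = {1, q}"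
    using assms by (auto simp: prime_nat_iff)
  have dpq: "{d. d dvd p * q} = {1, p, q, p * q}"
  proof (intro equalityI subsetI)
    fix d assume "d \<in> {d. d dvd p * q}"
    then obtain b c where "d = b * c" "b dvd p" "c dvd q" using division_decomp by blast
    then have "d = b * c" "b \<in> {1, p}" "c \<in> {1, q}" using dp by blast+
    then show "d \<in> {1, p, q, p * q}" by auto
  qed auto
  have 1: "monom 1 1 - 1 = ?F 1" using prod_primitive_roots_divisors[of 1] by simp
  have 2: "monom 1 p - 1 = ?F 1 * ?F p"
    using prod_primitive_roots_divisors[of p] dp p1 by simp
  have 3: "monom 1 q - 1 = ?F 1 * ?F q"
    using prod_primitive_roots_divisors[of q] dp p1 by simp
  have 4: "monom 1 (p * q) - 1 = ?F 1 * (?F p * (?F q * ?F (p * q)))"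
    using prod_primitive_roots_divisors[of "p * q"] dpq p1 pq assms(3) by simp
  have 5: "map_poly of_int (cyclotomic (p * q)) = ?F (p * q)"
    using of_int_cyclotomic[of "p * q"] p1 by simp
  show ?thesis unfolding 1 2 3 4 5 by (simp only: mult_ac)
qed

text \<open>
  By \<open>cyclotomic_pq_identity\<close> and \<open>fps_semigroup\<close>, both the cyclotomic polynomial and
  \<open>1 - X\<close> times the generating function of the semigroup solve the same linear equation over
  the integral domain of power series.
\<close>

lemma (in coprime_pair) coeff_cyclotomic_pq:
  assumes "prime p" "prime q"
  shows "coeff (cyclotomic (p * q)) j = of_bool (j \<in> S) - of_bool (0 < j \<and> j - 1 \<in> S)"
proof -
  let ?X = "fps_X :: complex fps"
  define I :: "complex fps" where "I = Abs_fps (\<lambda>n. of_bool (n \<in> S))"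
  define C :: "complex fps" where "C = fps_of_poly (map_poly of_int (cyclotomic (p * q)))"
  have "C * (?X ^ p - 1) * (?X ^ q - 1) = (?X ^ (p * q) - 1) * (?X ^ 1 - 1)"
    using arg_cong[OF cyclotomic_pq_identity[OF assms], of fps_of_poly] p_less_q
    by (simp only: C_def fps_of_poly_mult fps_of_poly_diff fps_of_poly_monom' fps_of_poly_1)
  also have "\<dots> = (1 - ?X ^ (p * q)) * (1 - ?X)" by (simp add: algebra_simps)
  also have "\<dots> = (1 - ?X) * I * (?X ^ p - 1) * (?X ^ q - 1)"
    unfolding I_def fps_semigroup[symmetric] by (simp add: algebra_simps)
  finally have "C * ((?X ^ p - 1) * (?X ^ q - 1)) = (1 - ?X) * I * ((?X ^ p - 1) * (?X ^ q - 1))"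
    by (simp only: mult.assoc)
  moreover have "?X ^ k - 1 \<noteq> 0" if "k > 0" for k
  proof
    assume "?X ^ k - 1 = 0"
    then have "(?X ^ k - 1) $ 0 = (0 :: complex fps) $ 0" by (rule arg_cong)
    then show False using that by (simp del: right_minus_eq)
  qed
  ultimately have "C = (1 - ?X) * I" using p_gt_1 p_less_q by simp
  then have "C $ j = ((1 - ?X) * I) $ j" by simp
  also have "\<dots> = of_bool (j \<in> S) - of_bool (0 < j \<and> j - 1 \<in> S)"
    using fps_X_power_mult_nth[of 1 I j] by (auto simp: left_diff_distrib I_def)
  also have "\<dots> = of_int (of_bool (j \<in> S) - of_bool (0 < j \<and> j - 1 \<in> S))" by simp
  finally show ?thesis by (simp only: C_def fps_of_poly_nth coeff_map_poly of_int_0 of_int_eq_iff)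
qed

lemma (in coprime_pair) cyclotomic_word_eq_diff_word:
  assumes "prime p" "prime q"
  shows "cyclotomic_word p q = diff_word"
  unfolding cyclotomic_word_def diff_word_def by (intro map_cong refl coeff_cyclotomic_pq assms)

theorem theorem3p1:
  fixes p q r m :: nat and a :: "int list"
  assumes "prime p" and "prime q" and "odd p" and "odd q" and "p < q"
    and "r = q mod p"
    and "m = (p - 1) * (q - 1)"
    and "a = cyclotomic_word p q"
  shows
    "(p \<ge> 3 \<longrightarrow>
        g1 a = p - 1 \<and>
        num_gaps_located a (g1 a) 0 (q - 1) = q div p \<and>
        num_gaps_located a (g1 a) (m - q + 1) m = q div p)
   \<and> (p \<ge> 5 \<and> r \<in> {2..p - 2} \<longrightarrow>
        g2 a = max (r - 1) (p - r - 1) \<and>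
        num_gaps_located a (g2 a) q (2 * q - 1) \<ge> q div p \<and>
        num_gaps_located a (g2 a) (m - 2 * q - 1) (m - q) \<ge> q div p)"
proof -
  have pq: "coprime_pair p q"
    using assms by unfold_locales (auto simp: primes_coprime prime_gt_Suc_0_nat)
  have a: "a = coprime_pair.diff_word p q"
    using coprime_pair.cyclotomic_word_eq_diff_word[OF pq] assms by simp
  have "g1 a = p - 1 \<and>
      num_gaps_located a (g1 a) 0 (q - 1) = q div p \<and>
      num_gaps_located a (g1 a) (m - q + 1) m = q div p" if "3 \<le> p"
    unfolding a assms(7) coprime_pair.g1_diff_word[OF pq that]
    using coprime_pair.num_gaps_located_diff_word_below_q[OF pq that]
      coprime_pair.num_gaps_located_diff_word_right_end[OF pq that] by blast
  moreover have "g2 a = max (r - 1) (p - r - 1) \<and>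
      num_gaps_located a (g2 a) q (2 * q - 1) \<ge> q div p \<and>
      num_gaps_located a (g2 a) (m - 2 * q - 1) (m - q) \<ge> q div p"
    if "5 \<le> p" "r \<in> {2..p - 2}"
    using coprime_pair.g2_diff_word[OF pq that(1)] that(2) unfolding a assms(6,7) by blast
  ultimately show ?thesis by blast
qed

end
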